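(* Let $\alpha_n(t)$, $n\geq 0$, $t\geq 0$, be the solution of the Schur flow \[ \alpha_n'(t)=(1-|\alpha_n(t)|^2)\,(\alpha_{n+1}(t)-\alpha_{n-1}(t)),\qquad n=0,1,2,\dots,\qquad \alpha_{-1}(t)\equiv -1, \] with initial conditions satisfying $\alpha_n(0)\in(-1,1)$ for every $n\geq 0$. Then exactly one of the following holds: (i) $\alpha_n(t)\to(-1)^n$ as $t\to\infty$ for all $n\geq 0$; (ii) there exist $1\leq N\leq\infty$ and real numbers $1>x_1>x_2>\cdots>x_N>-1$ such that, as $t\to\infty$, $\alpha_{2n}(t)\to 1$ for all $n\geq 0$, $\alpha_{2n-1}(t)\to -x_n$ for all $1\leq n<N$, and $\alpha_{2n-1}(t)\to -x_N$ for all $n\geq N$; (iii) there exist $1\leq N\leq\infty$ and real numbers $1>x_1>x_2>\cdots>x_N>-1$ such that, as $t\to\infty$, $\alpha_{2n+1}(t)\to -1$ for all $n\geq 0$, $\alpha_{2n}(t)\to x_{n+1}$ for all $0\leq n<N$, and $\alpha_{2n}(t)\to x_N$ for all $n\geq N-1$.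
   Context: $\mathbb{D}=\{z\in\mathbb{C}:|z|<1\}$. For initial data $(\alpha_n(0))_{n\geq0}\in\mathbb{D}^\infty$ the Schur flow system above has a unique global solution with $\alpha_n(t)\in\mathbb{D}$; when all $\alpha_n(0)$ are real, all $\alpha_n(t)$ are real. When $N=\infty$, the conditions involving $x_N$ are vacuous. *)

theory Defs
  imports "HOL-Analysis.Analysis" "HOL-Library.Extended_Nat"
begin

definition schur_flow_solution :: "(nat \<Rightarrow> real \<Rightarrow> complex) \<Rightarrow> bool" where
  "schur_flow_solution (a :: nat \<Rightarrow> real \<Rightarrow> complex) \<longleftrightarrow>
     (\<forall>n t. t \<ge> 0 \<longrightarrow> cmod (a n t) < 1) \<and>
     (\<forall>n t. t \<ge> 0 \<longrightarrow>
        ((\<lambda>s. a n s) has_vector_derivative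
           (of_real (1 - (cmod (a n t))\<^sup>2) *
            (a (Suc n) t - (if n = 0 then -1 else a (n - 1) t))))
        (at t within {0..}))"

definition admissible_params :: "enat \<Rightarrow> (nat \<Rightarrow> real) \<Rightarrow> bool" where
  "admissible_params N x \<longleftrightarrow> N \<ge> 1 \<and>
     (\<forall>n. 1 \<le> n \<and> enat n \<le> N \<longrightarrow> -1 < x n \<and> x n < 1) \<and>
     (\<forall>n m. 1 \<le> n \<and> n < m \<and> enat m \<le> N \<longrightarrow> x m < x n)"

definition case_i :: "(nat \<Rightarrow> real \<Rightarrow> complex) \<Rightarrow> bool" where
  "case_i \<alpha> \<longleftrightarrow> (\<forall>n. ((\<lambda>t. \<alpha> n t) \<longlongrightarrow> of_real ((-1) ^ n)) at_top)"

definition case_ii :: "(nat \<Rightarrow> real \<Rightarrow> complex) \<Rightarrow> bool" where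
  "case_ii \<alpha> \<longleftrightarrow> (\<exists>N x. admissible_params N x \<and>
     (\<forall>n. ((\<lambda>t. \<alpha> (2*n) t) \<longlongrightarrow> 1) at_top) \<and>
     (\<forall>n. 1 \<le> n \<and> enat n < N \<longrightarrow> ((\<lambda>t. \<alpha> (2*n - 1) t) \<longlongrightarrow> of_real (- x n)) at_top) \<and>
     (\<forall>n. 1 \<le> n \<and> N \<le> enat n \<longrightarrow>
        ((\<lambda>t. \<alpha> (2*n - 1) t) \<longlongrightarrow> of_real (- x (the_enat N))) at_top))"

definition case_iii :: "(nat \<Rightarrow> real \<Rightarrow> complex) \<Rightarrow> bool" where
  "case_iii \<alpha> \<longleftrightarrow> (\<exists>N x. admissible_params N x \<and>
     (\<forall>n. ((\<lambda>t. \<alpha> (2*n + 1) t) \<longlongrightarrow> -1) at_top) \<and>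
     (\<forall>n. enat n < N \<longrightarrow> ((\<lambda>t. \<alpha> (2*n) t) \<longlongrightarrow> of_real (x (n + 1))) at_top) \<and>
     (\<forall>n. N \<le> enat (n + 1) \<longrightarrow>
        ((\<lambda>t. \<alpha> (2*n) t) \<longlongrightarrow> of_real (x (the_enat N))) at_top))"

end

theory Submission
  imports Defs
begin

text \<open>
  Along a real solution, \<open>T\<^sub>m = \<alpha>\<^sub>0\<alpha>\<^sub>-\<^sub>1 + \<dots> + \<alpha>\<^sub>m\<alpha>\<^sub>m\<^sub>-\<^sub>1\<close> is nonincreasing and
  \<open>\<alpha>\<^sub>m - T\<^sub>m\<close> is nondecreasing; both are bounded, so every \<open>\<alpha>\<^sub>m\<close> converges, and its limit is a stationary point.
  The signs of the logarithmic derivatives of \<open>1 \<plusminus> \<alpha>\<^sub>m\<close> order the limits and give exponential convergence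
  to \<open>\<plusminus>1\<close> wherever two neighbouring limits differ. The limits stay away from \<open>-1\<close> because
  \<open>artanh \<alpha>\<^sub>0 + artanh \<alpha>\<^sub>2 + \<dots> + artanh \<alpha>\<^sub>2\<^sub>n\<close> has derivative \<open>1 + \<alpha>\<^sub>2\<^sub>n\<^sub>+\<^sub>1\<close>.

  If a block of at least two equal limits were followed by a different one, an entropy of the block would tend
  to 0 with an exponentially small derivative, hence would be exponentially small itself. It dominates an
  interior variable whose logarithmic derivative tends to 0, which rules out exponential decay.
\<close>

subsection \<open>Exponential decay\<close>

lemma deriv_nonneg_eventually_nondecreasing:
  fixes F F' :: "real \<Rightarrow> real"
  assumes "\<forall>\<^sub>F t in at_top. (F has_real_derivative F' t) (at t) \<and> 0 \<le> F' t"
  obtains t0 where "0 < t0" "\<And>s t. t0 \<le> s \<Longrightarrow> s \<le> t \<Longrightarrow> F s \<le> F t"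
proof -
  obtain t1 where t1: "\<And>t. t \<ge> t1 \<Longrightarrow> (F has_real_derivative F' t) (at t) \<and> 0 \<le> F' t"
    using assms unfolding eventually_at_top_linorder by blast
  have "F s \<le> F t" if "max 1 t1 \<le> s" "s \<le> t" for s t
    using that t1 by (intro DERIV_nonneg_imp_nondecreasing[OF that(2)]) (meson max.boundedE order_trans)
  then show ?thesis
    using that[of "max 1 t1"] by auto
qed

lemma nondecreasing_bounded_convergent:
  fixes F :: "real \<Rightarrow> real"
  assumes "\<And>s t. t0 \<le> s \<Longrightarrow> s \<le> t \<Longrightarrow> F s \<le> F t" "\<And>t. t0 \<le> t \<Longrightarrow> F t \<le> B"
  shows "\<exists>L. (F \<longlongrightarrow> L) at_top"
proof -
  have bdd: "bdd_above (F ` {t0..})"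
    using assms(2) by (auto intro!: bdd_aboveI2)
  define L where "L = Sup (F ` {t0..})"
  have "(F \<longlongrightarrow> L) at_top"
  proof (rule order_tendstoI)
    fix a assume "a < L"
    then obtain s where s: "t0 \<le> s" "a < F s"
      unfolding L_def using bdd by (subst (asm) less_cSup_iff) auto
    then show "\<forall>\<^sub>F t in at_top. a < F t"
      unfolding eventually_at_top_linorder using assms(1) by (meson less_le_trans)
  next
    fix a assume "L < a"
    moreover have "F t \<le> L" if "t0 \<le> t" for t
      unfolding L_def using that bdd by (intro cSup_upper) auto
    ultimately show "\<forall>\<^sub>F t in at_top. F t < a"
      unfolding eventually_at_top_linorder by (meson le_less_trans)
  qed
  then show ?thesis by blast
qed

text \<open>If \<open>c > 0\<close>, then \<open>F\<close> eventually grows at least as fast as a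
  line of slope \<open>c/2\<close>, so it cannot converge.\<close>

lemma deriv_limit_nonpos:
  fixes F :: "real \<Rightarrow> real"
  assumes "\<forall>\<^sub>F t in at_top. (F has_real_derivative F' t) (at t)"
    and "(F \<longlongrightarrow> L) at_top" "(F' \<longlongrightarrow> c) at_top"
  shows "c \<le> 0"
proof (rule ccontr)
  assume "\<not> c \<le> 0"
  then have "\<forall>\<^sub>F t in at_top. c/2 < F' t"
    using order_tendstoD(1)[OF assms(3), of "c/2"] by simp
  then have "\<forall>\<^sub>F t in at_top. ((\<lambda>t. F t - c/2 * t) has_real_derivative F' t - c/2) (at t) \<and> 0 \<le> F' t - c/2"
    using assms(1) by eventually_elim (auto intro!: derivative_eq_intros)
  then obtain t0 where t0: "0 < t0" "\<And>s t. t0 \<le> s \<Longrightarrow> s \<le> t \<Longrightarrow> F s - c/2 * s \<le> F t - c/2 * t"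
    by (rule deriv_nonneg_eventually_nondecreasing) blast
  have "filterlim (\<lambda>t. F t0 - c/2 * t0 + c/2 * t) at_top at_top"
    using \<open>\<not> c \<le> 0\<close>
    by (intro filterlim_tendsto_add_at_top[OF tendsto_const] filterlim_tendsto_pos_mult_at_top[OF tendsto_const _ filterlim_ident]) auto
  moreover have "\<forall>\<^sub>F t in at_top. F t0 - c/2 * t0 + c/2 * t \<le> F t"
    using eventually_ge_at_top[of t0] by eventually_elim (use t0(2) in force)
  ultimately have "filterlim F at_top at_top"
    by (rule filterlim_at_top_mono)
  then show False
    using assms(2) not_tendsto_and_filterlim_at_infinity filterlim_at_top_imp_at_infinity
      trivial_limit_at_top_linorder by blast
qed

lemma deriv_limit_eq_0:
  fixes F :: "real \<Rightarrow> real"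
  assumes "\<forall>\<^sub>F t in at_top. (F has_real_derivative F' t) (at t)"
    and "(F \<longlongrightarrow> L) at_top" "(F' \<longlongrightarrow> c) at_top"
  shows "c = 0"
proof (rule antisym)
  show "c \<le> 0"
    by (rule deriv_limit_nonpos[OF assms])
  have "\<forall>\<^sub>F t in at_top. ((\<lambda>t. - F t) has_real_derivative - F' t) (at t)"
    using assms(1) by eventually_elim (rule DERIV_minus)
  then show "0 \<le> c"
    using deriv_limit_nonpos[OF _ tendsto_minus[OF assms(2)] tendsto_minus[OF assms(3)]] by simp
qed

section \<open>Exponentially small functions and logarithmic derivatives\<close>

definition exp_small :: "(real \<Rightarrow> real) \<Rightarrow> bool" where
  "exp_small u \<longleftrightarrow> (\<exists>k>0. \<exists>C. \<forall>\<^sub>F t in at_top. \<bar>u t\<bar> \<le> C * exp (- k * t))"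

lemma exp_smallE:
  assumes "exp_small u"
  obtains k C where "0 < k" "0 < C" "\<forall>\<^sub>F t in at_top. \<bar>u t\<bar> \<le> C * exp (- k * t)"
proof -
  obtain k C where kC: "0 < k" "\<forall>\<^sub>F t in at_top. \<bar>u t\<bar> \<le> C * exp (- k * t)"
    using assms unfolding exp_small_def by blast
  have "\<forall>\<^sub>F t in at_top. \<bar>u t\<bar> \<le> max 1 C * exp (- k * t)"
    using kC(2) by eventually_elim (meson exp_ge_zero max.cobounded2 mult_right_mono order_trans)
  then show ?thesis
    using that kC(1) by (meson less_max_iff_disj zero_less_one)
qed

lemma exp_small_mono:
  assumes "exp_small v" "\<forall>\<^sub>F t in at_top. \<bar>u t\<bar> \<le> K * \<bar>v t\<bar>"
  shows "exp_small u"
proof -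
  obtain k C where kC: "0 < k" "0 < C" "\<forall>\<^sub>F t in at_top. \<bar>v t\<bar> \<le> C * exp (- k * t)"
    using assms(1) by (rule exp_smallE)
  have "\<forall>\<^sub>F t in at_top. \<bar>u t\<bar> \<le> \<bar>K\<bar> * C * exp (- k * t)"
    using assms(2) kC(3)
  proof eventually_elim
    case (elim t)
    have "\<bar>u t\<bar> \<le> \<bar>K\<bar> * \<bar>v t\<bar>"
      using elim(1) by (meson abs_ge_self abs_ge_zero mult_right_mono order_trans)
    also have "\<dots> \<le> \<bar>K\<bar> * (C * exp (- k * t))"
      using elim(2) by (intro mult_left_mono) auto
    finally show ?case by (simp add: mult.assoc)
  qed
  then show ?thesis
    unfolding exp_small_def using kC(1) by blast
qed

lemma exp_small_diff:
  assumes "exp_small u" "exp_small v"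
  shows "exp_small (\<lambda>t. u t - v t)"
proof -
  obtain k C where kC: "0 < k" "0 < C" "\<forall>\<^sub>F t in at_top. \<bar>u t\<bar> \<le> C * exp (- k * t)"
    using assms(1) by (rule exp_smallE)
  obtain m D where mD: "0 < m" "0 < D" "\<forall>\<^sub>F t in at_top. \<bar>v t\<bar> \<le> D * exp (- m * t)"
    using assms(2) by (rule exp_smallE)
  have "\<forall>\<^sub>F t in at_top. \<bar>u t - v t\<bar> \<le> (C + D) * exp (- min k m * t)"
    using kC(3) mD(3) eventually_ge_at_top[of 0]
  proof eventually_elim
    case (elim t)
    have "C * exp (- k * t) \<le> C * exp (- min k m * t)" "D * exp (- m * t) \<le> D * exp (- min k m * t)"
      using elim(3) kC(2) mD(2) by (auto intro!: mult_left_mono mult_right_mono)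
    then show ?case
      using elim by (simp add: distrib_right)
  qed
  then show ?thesis
    unfolding exp_small_def using kC(1) mD(1) by (metis min_less_iff_conj)
qed

lemma exp_small_mult_bounded:
  assumes "exp_small v" "\<forall>\<^sub>F t in at_top. \<bar>u t\<bar> \<le> K"
  shows "exp_small (\<lambda>t. u t * v t)"
proof (rule exp_small_mono[OF assms(1)])
  show "\<forall>\<^sub>F t in at_top. \<bar>u t * v t\<bar> \<le> K * \<bar>v t\<bar>"
    using assms(2) by eventually_elim (auto simp: abs_mult intro: mult_right_mono)
qed

lemma exp_neg_tendsto_0:
  fixes k :: real
  assumes "0 < k"
  shows "((\<lambda>t. exp (- k * t)) \<longlongrightarrow> 0) at_top"
  using assms
  by (intro filterlim_compose[OF exp_at_bot] filterlim_tendsto_neg_mult_at_bot[OF tendsto_const _ filterlim_ident]) simp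

text \<open>The function \<open>u t * exp (- (c/2) * t)\<close> has logarithmic derivative
  \<open>g t - c/2\<close>, which is eventually negative. So \<open>u\<close> decays at least at
  half of the limiting rate.\<close>

lemma exp_small_if_log_deriv_neg:
  assumes "\<forall>\<^sub>F t in at_top. (u has_real_derivative u t * g t) (at t)" "\<forall>\<^sub>F t in at_top. 0 < u t"
    and "(g \<longlongrightarrow> c) at_top" "c < 0"
  shows "exp_small u"
proof -
  have "\<forall>\<^sub>F t in at_top. g t < c/2"
    using order_tendstoD(2)[OF assms(3), of "c/2"] assms(4) by simp
  with assms(1,2) have "\<forall>\<^sub>F t in at_top.
     ((\<lambda>t. - (u t * exp (- (c/2) * t))) has_real_derivative u t * exp (- (c/2) * t) * (c/2 - g t)) (at t)
     \<and> 0 \<le> u t * exp (- (c/2) * t) * (c/2 - g t)"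
    by eventually_elim (intro conjI mult_nonneg_nonneg; (auto intro!: derivative_eq_intros simp: algebra_simps)?)
  then obtain t0 where t0: "0 < t0"
      "\<And>s t. t0 \<le> s \<Longrightarrow> s \<le> t \<Longrightarrow> - (u s * exp (- (c/2) * s)) \<le> - (u t * exp (- (c/2) * t))"
    by (rule deriv_nonneg_eventually_nondecreasing) blast
  have "\<forall>\<^sub>F t in at_top. \<bar>u t\<bar> \<le> u t0 * exp (- (c/2) * t0) * exp (- (- c/2) * t)"
    using eventually_ge_at_top[of t0] assms(2)
  proof eventually_elim
    case (elim t)
    have "u t = u t * exp (- (c/2) * t) * exp (- (- c/2) * t)"
      by (simp add: exp_minus)
    also have "\<dots> \<le> u t0 * exp (- (c/2) * t0) * exp (- (- c/2) * t)"
      using t0(2)[of t0 t] elim by (intro mult_right_mono) auto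
    finally show ?case using elim by simp
  qed
  then show ?thesis
    unfolding exp_small_def using assms(4) by (intro exI[of _ "- c/2"]) auto
qed

text \<open>Against a supposed decay rate \<open>k\<close>: eventually \<open>g t > - (k/2)\<close>,
  so \<open>u t * exp (k/2 * t)\<close> is nondecreasing and \<open>u\<close> decays at most at rate
  \<open>k/2\<close>. The case of interest is \<open>c = 0\<close>, where \<open>u\<close> may still
  tend to 0.\<close>

lemma not_exp_small_if_log_deriv_nonneg:
  assumes "\<forall>\<^sub>F t in at_top. (u has_real_derivative u t * g t) (at t)" "\<forall>\<^sub>F t in at_top. 0 < u t"
    and "(g \<longlongrightarrow> c) at_top" "0 \<le> c"
  shows "\<not> exp_small u"
proof
  assume "exp_small u"
  then obtain k C where kC: "0 < k" "0 < C" "\<forall>\<^sub>F t in at_top. \<bar>u t\<bar> \<le> C * exp (- k * t)"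
    by (rule exp_smallE)
  have "\<forall>\<^sub>F t in at_top. - (k/2) < g t"
    using order_tendstoD(1)[OF assms(3), of "- (k/2)"] assms(4) kC(1) by simp
  with assms(1,2) have "\<forall>\<^sub>F t in at_top.
     ((\<lambda>t. u t * exp (k/2 * t)) has_real_derivative u t * exp (k/2 * t) * (g t + k/2)) (at t)
     \<and> 0 \<le> u t * exp (k/2 * t) * (g t + k/2)"
    by eventually_elim (intro conjI mult_nonneg_nonneg; (auto intro!: derivative_eq_intros simp: algebra_simps)?)
  then obtain t0 where t0: "0 < t0"
      "\<And>s t. t0 \<le> s \<Longrightarrow> s \<le> t \<Longrightarrow> u s * exp (k/2 * s) \<le> u t * exp (k/2 * t)"
    by (rule deriv_nonneg_eventually_nondecreasing) blast
  obtain t1 where t1: "t0 \<le> t1" "0 < u t1"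
    using eventually_happens[OF eventually_conj[OF assms(2) eventually_ge_at_top[of t0]]] by auto
  have "((\<lambda>t. C * exp (- (k/2) * t)) \<longlongrightarrow> C * 0) at_top"
    using kC(1) by (intro tendsto_mult tendsto_const exp_neg_tendsto_0) simp
  moreover have "\<forall>\<^sub>F t in at_top. u t1 * exp (k/2 * t1) \<le> C * exp (- (k/2) * t)"
    using kC(3) eventually_ge_at_top[of t1]
  proof eventually_elim
    case (elim t)
    have "u t1 * exp (k/2 * t1) \<le> u t * exp (k/2 * t)"
      using t0(2) t1(1) elim by blast
    also have "\<dots> \<le> C * exp (- k * t) * exp (k/2 * t)"
      using elim by (intro mult_right_mono) auto
    also have "\<dots> = C * exp (- (k/2) * t)"
      by (simp add: mult.assoc flip: exp_add)
    finally show ?case .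
  qed
  ultimately have "u t1 * exp (k/2 * t1) \<le> C * 0"
    using tendsto_lowerbound trivial_limit_at_top_linorder by blast
  then show False
    using t1(2) by (simp add: mult_le_0_iff not_le)
qed

text \<open>A positive limit of \<open>g\<close> would make the positive function \<open>u\<close>
  eventually nondecreasing and so keep it away from 0.\<close>

lemma log_deriv_limit_nonpos:
  assumes "\<forall>\<^sub>F t in at_top. (u has_real_derivative u t * g t) (at t)" "\<forall>\<^sub>F t in at_top. 0 < u t"
    and "(g \<longlongrightarrow> c) at_top" "(u \<longlongrightarrow> 0) at_top"
  shows "c \<le> 0"
proof (rule ccontr)
  assume "\<not> c \<le> 0"
  then have "\<forall>\<^sub>F t in at_top. 0 < g t"
    using order_tendstoD(1)[OF assms(3), of 0] by simp
  with assms(1,2) have "\<forall>\<^sub>F t in at_top. (u has_real_derivative u t * g t) (at t) \<and> 0 \<le> u t * g t"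
    by eventually_elim auto
  then obtain t0 where t0: "0 < t0" "\<And>s t. t0 \<le> s \<Longrightarrow> s \<le> t \<Longrightarrow> u s \<le> u t"
    by (rule deriv_nonneg_eventually_nondecreasing) blast
  obtain t1 where t1: "t0 \<le> t1" "0 < u t1"
    using eventually_happens[OF eventually_conj[OF assms(2) eventually_ge_at_top[of t0]]] by auto
  have "\<forall>\<^sub>F t in at_top. u t1 \<le> u t"
    using eventually_ge_at_top[of t1] by eventually_elim (use t0(2) t1(1) in blast)
  then have "u t1 \<le> 0"
    using tendsto_lowerbound[OF assms(4)] trivial_limit_at_top_linorder by blast
  with t1(2) show False by simp
qed

text \<open>Since \<open>G\<close> tends to 0, it is minus the tail integral of \<open>G'\<close>.
  In terms of monotonicity: \<open>G t - C/k * exp (- k * t)\<close> is eventually nondecreasing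
  with limit 0, hence nonpositive.\<close>

lemma exp_small_integral_bound:
  assumes "\<forall>\<^sub>F t in at_top. (G has_real_derivative G' t) (at t)"
    and "0 < k" "\<forall>\<^sub>F t in at_top. \<bar>G' t\<bar> \<le> C * exp (- k * t)" "(G \<longlongrightarrow> 0) at_top"
  shows "\<forall>\<^sub>F t in at_top. G t \<le> C/k * exp (- k * t)"
proof -
  have "\<forall>\<^sub>F t in at_top. ((\<lambda>t. G t - C/k * exp (- k * t)) has_real_derivative G' t + C * exp (- k * t)) (at t)
      \<and> 0 \<le> G' t + C * exp (- k * t)"
    using assms(1,3) by eventually_elim (use \<open>0 < k\<close> in \<open>auto intro!: derivative_eq_intros\<close>)
  then obtain t0 where t0: "0 < t0"
      "\<And>s t. t0 \<le> s \<Longrightarrow> s \<le> t \<Longrightarrow> G s - C/k * exp (- k * s) \<le> G t - C/k * exp (- k * t)"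
    by (rule deriv_nonneg_eventually_nondecreasing) blast
  have lim: "((\<lambda>t. G t - C/k * exp (- k * t)) \<longlongrightarrow> 0 - C/k * 0) at_top"
    using assms(2,4) by (intro tendsto_diff tendsto_mult tendsto_const exp_neg_tendsto_0)
  show ?thesis
    using eventually_ge_at_top[of t0]
  proof eventually_elim
    case (elim s)
    have "\<forall>\<^sub>F t in at_top. G s - C/k * exp (- k * s) \<le> G t - C/k * exp (- k * t)"
      using eventually_ge_at_top[of s] by eventually_elim (use t0(2) elim in blast)
    then have "G s - C/k * exp (- k * s) \<le> 0 - C/k * 0"
      using tendsto_lowerbound[OF lim] trivial_limit_at_top_linorder by blast
    then show ?case by simp
  qed
qed

lemma exp_small_if_deriv_exp_small:
  assumes "\<forall>\<^sub>F t in at_top. (G has_real_derivative G' t) (at t)"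
    and "exp_small G'" "(G \<longlongrightarrow> 0) at_top"
  shows "exp_small G"
proof -
  obtain k C where kC: "0 < k" "0 < C" "\<forall>\<^sub>F t in at_top. \<bar>G' t\<bar> \<le> C * exp (- k * t)"
    using assms(2) by (rule exp_smallE)
  have "\<forall>\<^sub>F t in at_top. ((\<lambda>t. - G t) has_real_derivative - G' t) (at t)"
    using assms(1) by eventually_elim (rule DERIV_minus)
  from exp_small_integral_bound[OF this kC(1), of C] kC(3) tendsto_minus[OF assms(3)]
  have "\<forall>\<^sub>F t in at_top. - G t \<le> C/k * exp (- k * t)"
    by simp
  with exp_small_integral_bound[OF assms(1) kC(1,3) assms(3)]
  have "\<forall>\<^sub>F t in at_top. \<bar>G t\<bar> \<le> C/k * exp (- k * t)"
    by eventually_elim simp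
  then show ?thesis
    unfolding exp_small_def using kC(1) by blast
qed

subsection \<open>Limits of the flow\<close>

text \<open>In the coordinates \<open>v\<^sub>n = 1 - (-1)\<^sup>n\<^sup>-\<^sup>1 \<alpha>\<^sub>n\<^sub>-\<^sub>1\<close> the boundary value \<open>\<alpha>\<^sub>-\<^sub>1 = -1\<close> becomes
  \<open>v\<^sub>0 = 0\<close>, and the system is invariant under the index shift \<open>v\<^sub>n \<mapsto> v\<^sub>n\<^sub>+\<^sub>1\<close>. The function \<open>v\<^sub>0\<close> is left
  free so that case (ii) is case (iii) of the shifted system.\<close>

locale schur_flow =
  fixes v :: "nat \<Rightarrow> real \<Rightarrow> real"
  assumes v_0_bounds: "0 < t \<Longrightarrow> 0 \<le> v 0 t" "0 < t \<Longrightarrow> v 0 t \<le> 2"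
    and v_Suc_bounds: "0 < t \<Longrightarrow> 0 < v (Suc n) t" "0 < t \<Longrightarrow> v (Suc n) t < 2"
    and v_deriv: "0 < t \<Longrightarrow> (v (Suc n) has_real_derivative
      v (Suc n) t * (2 - v (Suc n) t) * (v n t - v (Suc (Suc n)) t)) (at t)"
begin

lemma v_bounds:
  assumes "0 < t"
  shows "0 \<le> v n t" "v n t \<le> 2"
  using v_0_bounds[OF assms] v_Suc_bounds[OF assms] by (cases n; auto intro: less_imp_le)+

text \<open>For the coordinates of the Schur flow the sum is \<open>- T\<^sub>m\<close>. The
  derivative of each new summand is the difference of the right-hand sides for \<open>Suc m\<close>
  and \<open>m\<close>, so the sum telescopes; \<open>v 0 = 0\<close> starts the induction.\<close>

lemma product_sum_deriv:
  assumes "\<And>t. v 0 t = 0" "0 < t"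
  shows "((\<lambda>t. \<Sum>j\<le>m. (1 - v j t) * (1 - v (Suc j) t)) has_real_derivative
    v (Suc m) t * (2 - v (Suc m) t) * (1 - (1 - v m t) * (1 - v (Suc (Suc m)) t))) (at t)"
proof (induction m)
  case 0
  then show ?case
    using v_deriv[OF assms(2), of 0] by (auto intro!: derivative_eq_intros simp: assms(1))
next
  case (Suc m)
  have "((\<lambda>t. (1 - v (Suc m) t) * (1 - v (Suc (Suc m)) t)) has_real_derivative
     - (v (Suc m) t * (2 - v (Suc m) t) * (v m t - v (Suc (Suc m)) t)) * (1 - v (Suc (Suc m)) t)
     - (v (Suc (Suc m)) t * (2 - v (Suc (Suc m)) t) * (v (Suc m) t - v (Suc (Suc (Suc m))) t)) * (1 - v (Suc m) t)) (at t)"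
    using v_deriv[OF assms(2), of m] v_deriv[OF assms(2), of "Suc m"]
    by (auto intro!: derivative_eq_intros)
  then show ?case
    unfolding sum.atMost_Suc by (rule DERIV_cong[OF DERIV_add[OF Suc.IH]]) algebra
qed

text \<open>\<open>v n\<close> is the difference of the bounded nondecreasing functions
  \<open>S + v n\<close> and \<open>S\<close>. The derivative of the former factors because
  \<open>1 - (1 - x) * (1 - y) + (x - y) = x * (2 - y)\<close>.\<close>

lemma convergent_if_v_0_eq_0:
  assumes "\<And>t. v 0 t = 0"
  shows "\<exists>L. (v n \<longlongrightarrow> L) at_top"
proof (cases n)
  case 0
  with assms have "v n = (\<lambda>_. 0)" by auto
  then show ?thesis by auto
next
  case (Suc m)
  define S where "S = (\<lambda>t. \<Sum>j\<le>m. (1 - v j t) * (1 - v (Suc j) t))"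
  define S' where "S' = (\<lambda>t. v (Suc m) t * (2 - v (Suc m) t) * (1 - (1 - v m t) * (1 - v (Suc (Suc m)) t)))"
  have prod_le: "\<bar>(1 - v i t) * (1 - v j t)\<bar> \<le> 1" if "0 < t" for i j t
    using v_bounds[OF that, of i] v_bounds[OF that, of j] unfolding abs_mult
    by (intro mult_le_one) auto
  have S_le: "S t \<le> Suc m" if "0 < t" for t
  proof -
    have "S t \<le> (\<Sum>j\<le>m. 1)"
      unfolding S_def using prod_le[OF that] by (intro sum_mono) (meson abs_le_D1)
    then show ?thesis by simp
  qed
  have S_deriv: "(S has_real_derivative S' t) (at t)" if "0 < t" for t
    unfolding S_def S'_def using product_sum_deriv[OF assms that] .
  have "\<forall>\<^sub>F t in at_top. (S has_real_derivative S' t) (at t) \<and> 0 \<le> S' t"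
    using eventually_gt_at_top[of 0]
  proof eventually_elim
    case (elim t)
    show ?case
      using S_deriv[OF elim] abs_le_D1[OF prod_le[OF elim]] v_bounds[OF elim]
      unfolding S'_def by (simp add: diff_le_eq)
  qed
  then obtain t0 where t0: "0 < t0" "\<And>s t. t0 \<le> s \<Longrightarrow> s \<le> t \<Longrightarrow> S s \<le> S t"
    by (rule deriv_nonneg_eventually_nondecreasing) blast
  have "S t \<le> Suc m" if "t0 \<le> t" for t
    using S_le t0(1) that by simp
  then obtain A where A: "(S \<longlongrightarrow> A) at_top"
    using nondecreasing_bounded_convergent[where F = S, OF t0(2)] by blast
  have "\<forall>\<^sub>F t in at_top. ((\<lambda>t. S t + v n t) has_real_derivative
      v n t * (2 - v n t) * v m t * (2 - v (Suc n) t)) (at t) \<and>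
      0 \<le> v n t * (2 - v n t) * v m t * (2 - v (Suc n) t)"
    using eventually_gt_at_top[of 0]
  proof eventually_elim
    case (elim t)
    have "((\<lambda>t. S t + v n t) has_real_derivative
      v n t * (2 - v n t) * v m t * (2 - v (Suc n) t)) (at t)"
      by (rule DERIV_cong[OF DERIV_add[OF S_deriv[OF elim] v_deriv[OF elim, of m, folded Suc]]])
        (simp add: S'_def Suc algebra_simps)
    then show ?case
      using v_bounds[OF elim] by simp
  qed
  then obtain t1 where t1: "0 < t1" "\<And>s t. t1 \<le> s \<Longrightarrow> s \<le> t \<Longrightarrow> S s + v n s \<le> S t + v n t"
    by (rule deriv_nonneg_eventually_nondecreasing) blast
  have "S t + v n t \<le> Suc m + 2" if "t1 \<le> t" for t
    using S_le[of t] v_bounds(2)[of t n] t1(1) that by simp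
  then obtain B where B: "((\<lambda>t. S t + v n t) \<longlongrightarrow> B) at_top"
    using nondecreasing_bounded_convergent[where F = "\<lambda>t. S t + v n t", OF t1(2)] by blast
  from tendsto_diff[OF B A] show ?thesis by auto
qed

end

section \<open>Constraints on the limits of a convergent flow\<close>

locale convergent_schur_flow = schur_flow +
  fixes m :: "nat \<Rightarrow> real"
  assumes v_tendsto: "(v n \<longlongrightarrow> m n) at_top"
begin

lemma shift: "convergent_schur_flow (\<lambda>n. v (Suc n)) (\<lambda>n. m (Suc n))"
  using v_bounds v_Suc_bounds v_deriv v_tendsto by unfold_locales auto

lemma m_bounds: "0 \<le> m n" "m n \<le> 2"
proof -
  have "\<forall>\<^sub>F t in at_top. 0 \<le> v n t" "\<forall>\<^sub>F t in at_top. v n t \<le> 2"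
    by (rule eventually_mono[OF eventually_gt_at_top[of 0]]; use v_bounds in blast)+
  then show "0 \<le> m n" "m n \<le> 2"
    using tendsto_lowerbound[OF v_tendsto] tendsto_upperbound[OF v_tendsto] by auto
qed

lemma eventually_v_deriv:
  "\<forall>\<^sub>F t in at_top. (v (Suc n) has_real_derivative
      v (Suc n) t * ((2 - v (Suc n) t) * (v n t - v (Suc (Suc n)) t))) (at t)"
  using eventually_gt_at_top[of 0] by eventually_elim (use v_deriv in \<open>simp add: mult.assoc\<close>)

lemma eventually_v_pos: "\<forall>\<^sub>F t in at_top. 0 < v (Suc n) t"
  using eventually_gt_at_top[of 0] by eventually_elim (rule v_Suc_bounds)

lemma log_deriv_tendsto:
  "((\<lambda>t. (2 - v (Suc n) t) * (v n t - v (Suc (Suc n)) t)) \<longlongrightarrow>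
     (2 - m (Suc n)) * (m n - m (Suc (Suc n)))) at_top"
  by (intro tendsto_intros v_tendsto)

lemma m_stationary: "m (Suc n) * ((2 - m (Suc n)) * (m n - m (Suc (Suc n)))) = 0"
  by (rule deriv_limit_eq_0[OF eventually_v_deriv[of n] v_tendsto])
    (intro tendsto_mult[OF v_tendsto log_deriv_tendsto])

text \<open>The logarithmic derivative of \<open>v (Suc n)\<close> tends to
  \<open>2 * (m n - m (Suc (Suc n)))\<close>, which cannot be positive while
  \<open>v (Suc n)\<close> tends to 0.\<close>

lemma m_le_if_0_between: "m (Suc n) = 0 \<Longrightarrow> m n \<le> m (Suc (Suc n))"
  using log_deriv_limit_nonpos[OF eventually_v_deriv[of n] eventually_v_pos log_deriv_tendsto]
    v_tendsto[of "Suc n"] by simp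

lemma exp_small_if_m_less:
  assumes "m (Suc n) = 0" "m n < m (Suc (Suc n))"
  shows "exp_small (v (Suc n))"
  using exp_small_if_log_deriv_neg[OF eventually_v_deriv eventually_v_pos log_deriv_tendsto] assms
  by simp

text \<open>Between equal neighbouring limits the logarithmic derivative tends to 0. Both later
  arguments that propagate exponential smallness end in a contradiction with this.\<close>

lemma not_exp_small_if_m_eq:
  assumes "m n = m (Suc (Suc n))"
  shows "\<not> exp_small (v (Suc n))"
  using not_exp_small_if_log_deriv_nonneg[OF eventually_v_deriv eventually_v_pos log_deriv_tendsto] assms
  by simp

text \<open>This yields case (i). At the first index \<open>n\<close> with \<open>m n > 0\<close>,
  the preceding variable is exponentially small, because its own limit and that of its left
  neighbour are 0. A logarithmic sum transfers the smallness back to \<open>v 1\<close>, whose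
  neighbours have equal limits.\<close>

lemma tendsto_0_if_m_1_2_eq_0:
  assumes "\<And>t. v 0 t = 0" "m 1 = 0" "m 2 = 0"
  shows "m n = 0"
proof (induction n rule: less_induct)
  case (less n)
  have m_0: "m 0 = 0"
  proof -
    have "v 0 = (\<lambda>_. 0)"
      using assms(1) by auto
    then show ?thesis
      using v_tendsto[of 0] by (simp add: tendsto_const_iff)
  qed
  show ?case
  proof (rule ccontr)
    assume "m n \<noteq> 0"
    then have "n \<noteq> 0" "n \<noteq> 1" "n \<noteq> 2"
      using m_0 assms(2,3) by metis+
    then obtain k where k: "n = Suc (Suc (Suc k))"
      by (metis One_nat_def Suc_1 not0_implies_Suc)
    have small: "exp_small (v (Suc (Suc k)))"
      using less.IH[of "Suc (Suc k)"] less.IH[of "Suc k"] \<open>m n \<noteq> 0\<close> m_bounds(1)[of n] k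
      by (intro exp_small_if_m_less) auto
    \<comment> \<open>Each summand \<open>- ln (1 - v i t / 2)\<close> has derivative
      \<open>v i t * (v (i - 1) t - v (i + 1) t)\<close>, a difference of products of neighbours.
      Since \<open>v 0 = 0\<close>, only the product at the right end survives.\<close>
    define G where "G = (\<lambda>t. \<Sum>j\<le>k. - ln (1 - v (Suc j) t / 2))"
    have G_deriv: "(G has_real_derivative - (v (Suc k) t * v (Suc (Suc k)) t)) (at t)" if "0 < t" for t
      unfolding G_def
    proof (induction k)
      case 0
      show ?case
        using v_deriv[OF that, of 0] v_Suc_bounds[OF that, of 0] assms(1)
        by (auto intro!: derivative_eq_intros simp: field_simps)
    next
      case (Suc k)
      have "((\<lambda>t. - ln (1 - v (Suc (Suc k)) t / 2)) has_real_derivative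
          v (Suc (Suc k)) t * (v (Suc k) t - v (Suc (Suc (Suc k))) t)) (at t)"
        using v_deriv[OF that, of "Suc k"] v_Suc_bounds[OF that, of "Suc k"]
        by (auto intro!: derivative_eq_intros simp: field_simps)
      from DERIV_add[OF Suc this] show ?case
        by (simp, elim DERIV_cong) (simp add: algebra_simps)
    qed
    have small': "exp_small (\<lambda>t. - v (Suc k) t * v (Suc (Suc k)) t)"
    proof (rule exp_small_mult_bounded[OF small])
      show "\<forall>\<^sub>F t in at_top. \<bar>- v (Suc k) t\<bar> \<le> 2"
        using eventually_gt_at_top[of 0] by eventually_elim (use v_bounds in auto)
    qed
    have deriv: "\<forall>\<^sub>F t in at_top. (G has_real_derivative - v (Suc k) t * v (Suc (Suc k)) t) (at t)"
      using eventually_gt_at_top[of 0] by eventually_elim (use G_deriv in simp)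
    have "(G \<longlongrightarrow> (\<Sum>j\<le>k. - ln (1 - m (Suc j) / 2))) at_top"
      unfolding G_def using less.IH k by (intro tendsto_intros v_tendsto) auto
    then have "(G \<longlongrightarrow> 0) at_top"
      using less.IH k by simp
    from exp_small_if_deriv_exp_small[OF deriv small' this] have "exp_small G" .
    \<comment> \<open>All summands of \<open>G\<close> are nonnegative and
      \<open>- ln (1 - x) \<ge> x\<close>, so \<open>G\<close> dominates
      \<open>v 1 / 2\<close>.\<close>
    then have "exp_small (v 1)"
    proof (rule exp_small_mono)
      show "\<forall>\<^sub>F t in at_top. \<bar>v 1 t\<bar> \<le> 2 * \<bar>G t\<bar>"
        using eventually_gt_at_top[of 0]
      proof eventually_elim
        case (elim t)
        have ge: "v (Suc j) t / 2 \<le> - ln (1 - v (Suc j) t / 2)" for j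
          using ln_le_minus_one[of "1 - v (Suc j) t / 2"] v_Suc_bounds[OF elim, of j] by simp
        have "0 \<le> - ln (1 - v (Suc j) t / 2)" for j
          using ge[of j] v_bounds(1)[OF elim, of "Suc j"] by linarith
        then have "- ln (1 - v (Suc 0) t / 2) \<le> G t"
          unfolding G_def by (intro member_le_sum[where f = "\<lambda>j. - ln (1 - v (Suc j) t / 2)"]) auto
        then have "v 1 t / 2 \<le> G t"
          using ge[of 0] by simp
        then show ?case
          using v_bounds(1)[OF elim, of 1] by simp
      qed
    qed
    then show False
      using not_exp_small_if_m_eq[of 0] m_0 assms(3) by (simp add: numeral_2_eq_2)
  qed
qed

end

subsection \<open>Interior limits and their strict monotonicity\<close>

lemma exp_small_tendsto_0:
  assumes "exp_small u"
  shows "(u \<longlongrightarrow> 0) at_top"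
proof -
  obtain k C where kC: "0 < k" "\<forall>\<^sub>F t in at_top. \<bar>u t\<bar> \<le> C * exp (- k * t)"
    using assms by (rule exp_smallE)
  have "((\<lambda>t. C * exp (- k * t)) \<longlongrightarrow> C * 0) at_top"
    using kC(1) by (intro tendsto_mult tendsto_const exp_neg_tendsto_0)
  then show ?thesis
    using kC(2) by (intro Lim_null_comparison[of u "\<lambda>t. C * exp (- k * t)"]) simp_all
qed

text \<open>Gibbs' inequality for the two-point distributions with weights \<open>1 - a/2\<close>,
  \<open>a/2\<close> and \<open>1 - s/2\<close>, \<open>s/2\<close>. Applying
  \<open>ln x \<le> x - 1\<close> to both ratios suffices, since the weighted linear terms
  cancel.\<close>

lemma binary_entropy_ge:
  fixes a s :: real
  assumes "0 < a" "a < 2" "0 < s" "s < 2"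
  shows "(2 - a)/2 * ln (2 - s) + a/2 * ln s \<le> (2 - a)/2 * ln (2 - a) + a/2 * ln a"
proof -
  have "ln ((2 - s) / (2 - a)) \<le> (2 - s) / (2 - a) - 1" "ln (s / a) \<le> s / a - 1"
    using assms by (auto intro!: ln_le_minus_one)
  then have "(2 - a)/2 * ln ((2 - s) / (2 - a)) + a/2 * ln (s / a)
      \<le> (2 - a)/2 * ((2 - s) / (2 - a) - 1) + a/2 * (s / a - 1)"
    using assms by (intro add_mono mult_left_mono) auto
  also have "\<dots> = 0"
    using assms by (simp add: field_simps)
  finally have "(2 - a)/2 * (ln (2 - s) - ln (2 - a)) + a/2 * (ln s - ln a) \<le> 0"
    using assms by (simp add: ln_div)
  then show ?thesis
    unfolding right_diff_distrib by linarith
qed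

context convergent_schur_flow
begin

text \<open>Each summand is \<open>artanh (1 - v (2*k+1) t)\<close>; its derivative
  \<open>v (2*k+2) t - v (2*k) t\<close> telescopes.\<close>

lemma logit_sum_deriv:
  assumes "0 < t"
  shows "((\<lambda>t. \<Sum>k<n. (ln (2 - v (2*k+1) t) - ln (v (2*k+1) t)) / 2) has_real_derivative
    v (2*n) t - v 0 t) (at t)"
proof (induction n)
  case 0
  then show ?case by simp
next
  case (Suc n)
  have "((\<lambda>t. (ln (2 - v (2*n+1) t) - ln (v (2*n+1) t)) / 2) has_real_derivative
    v (2 * Suc n) t - v (2*n) t) (at t)"
    using v_deriv[OF assms, of "2*n"] v_Suc_bounds[OF assms, of "2*n"]
    by (auto intro!: derivative_eq_intros simp: field_simps)
  then show ?case
    unfolding sum.lessThan_Suc by (rule DERIV_cong[OF DERIV_add[OF Suc.IH]]) simp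
qed

text \<open>\<open>ln (2 - v (2*n+1) t)\<close> falls at rate at most \<open>2 * v (2*n) t\<close>,
  while twice the logit sum grows at rate \<open>2 * (v (2*n) t - v 0 t)\<close>. As that sum stays
  bounded and \<open>v 0\<close> is integrable, \<open>2 - v (2*n+1) t\<close> stays away from
  0.\<close>

lemma less_2_if_logit_sum_convergent:
  assumes "exp_small (v 0)"
    and "((\<lambda>t. \<Sum>k<n. (ln (2 - v (2*k+1) t) - ln (v (2*k+1) t)) / 2) \<longlongrightarrow> L) at_top"
  shows "m (2*n+1) < 2"
proof -
  define B where "B = (\<lambda>t. \<Sum>k<n. (ln (2 - v (2*k+1) t) - ln (v (2*k+1) t)) / 2)"
  obtain k C where kC: "0 < k" "0 < C" "\<forall>\<^sub>F t in at_top. \<bar>v 0 t\<bar> \<le> C * exp (- k * t)"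
    using assms(1) by (rule exp_smallE)
  \<comment> \<open>The exponential term contributes \<open>2 * C * exp (- k * t)\<close> to the
    derivative and absorbs the remaining \<open>- 2 * v 0 t\<close>; this makes \<open>Q\<close>
    nondecreasing.\<close>
  define Q where "Q = (\<lambda>t. ln (2 - v (2*n+1) t) + 2 * B t - 2 * C / k * exp (- k * t))"
  define Q' where "Q' = (\<lambda>t. - (v (2*n+1) t * (v (2*n) t - v (2*n+2) t))
      + 2 * (v (2*n) t - v 0 t) + 2 * C * exp (- k * t))"
  have "\<forall>\<^sub>F t in at_top. (Q has_real_derivative Q' t) (at t) \<and> 0 \<le> Q' t"
    using eventually_gt_at_top[of 0] kC(3)
  proof eventually_elim
    case (elim t)
    have d1: "((\<lambda>t. ln (2 - v (2*n+1) t)) has_real_derivative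
        - (v (2*n+1) t * (v (2*n) t - v (2*n+2) t))) (at t)"
      using v_deriv[OF elim(1), of "2*n"] v_Suc_bounds[OF elim(1), of "2*n"]
      by (auto intro!: derivative_eq_intros simp: field_simps)
    have d2: "((\<lambda>t. 2 * B t) has_real_derivative 2 * (v (2*n) t - v 0 t)) (at t)"
      unfolding B_def using logit_sum_deriv[OF elim(1)] by (rule DERIV_cmult)
    have d3: "((\<lambda>t. 2 * C / k * exp (- k * t)) has_real_derivative - (2 * C * exp (- k * t))) (at t)"
      using kC(1) by (auto intro!: derivative_eq_intros)
    have "(Q has_real_derivative Q' t) (at t)"
      unfolding Q_def Q'_def using DERIV_diff[OF DERIV_add[OF d1 d2] d3] by simp
    moreover have "v (2*n+1) t * v (2*n) t \<le> 2 * v (2*n) t" "0 \<le> v (2*n+1) t * v (2*n+2) t"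
      using v_bounds[OF elim(1)] by (auto intro: mult_right_mono)
    then have "0 \<le> Q' t"
      unfolding Q'_def using elim(2) by (simp add: right_diff_distrib)
    ultimately show ?case ..
  qed
  then obtain t0 where t0: "0 < t0" "\<And>s t. t0 \<le> s \<Longrightarrow> s \<le> t \<Longrightarrow> Q s \<le> Q t"
    by (rule deriv_nonneg_eventually_nondecreasing) blast
  have "\<forall>\<^sub>F t in at_top. B t < L + 1"
    using order_tendstoD(2)[OF assms(2), of "L + 1"] unfolding B_def by simp
  then have "\<forall>\<^sub>F t in at_top. exp (Q t0 - 2 * (L + 1)) \<le> 2 - v (2*n+1) t"
    using eventually_ge_at_top[of t0]
  proof eventually_elim
    case (elim t)
    have "0 \<le> 2 * C / k * exp (- k * t)"
      using kC by simp
    then have "Q t0 - 2 * (L + 1) \<le> ln (2 - v (2*n+1) t)"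
      using t0(2)[OF order_refl elim(2)] elim(1) unfolding Q_def by simp
    then show ?case
      using v_Suc_bounds(2)[of t "2*n"] elim(2) t0(1) by (simp add: ln_ge_iff)
  qed
  moreover have "((\<lambda>t. 2 - v (2*n+1) t) \<longlongrightarrow> 2 - m (2*n+1)) at_top"
    by (intro tendsto_intros v_tendsto)
  ultimately have "exp (Q t0 - 2 * (L + 1)) \<le> 2 - m (2*n+1)"
    using tendsto_lowerbound trivial_limit_at_top_linorder by blast
  then show ?thesis
    using exp_gt_zero[of "Q t0 - 2 * (L + 1)"] by linarith
qed

text \<open>The claims need each other in the induction. An odd limit strictly between 0 and 2
  forces, by stationarity, the next even limit to equal the previous one, namely 0. A zero even
  limit makes the next odd limit at least as large, hence positive; convergence of the logit sum
  keeps it below 2.\<close>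

lemma limits_if_exp_small_0:
  assumes "exp_small (v 0)" "0 < m 1"
  shows "m (2*n) = 0 \<and> 0 < m (2*n+1) \<and> m (2*n+1) < 2 \<and>
    (\<exists>L. ((\<lambda>t. \<Sum>k<n. (ln (2 - v (2*k+1) t) - ln (v (2*k+1) t)) / 2) \<longlongrightarrow> L) at_top)"
proof (induction n)
  case 0
  have "m 0 = 0"
    using tendsto_unique[OF trivial_limit_at_top_linorder v_tendsto exp_small_tendsto_0] assms(1) by blast
  then show ?case
    using less_2_if_logit_sum_convergent[OF assms(1), of 0] assms(2) by auto
next
  case (Suc n)
  have "((\<lambda>t. (ln (2 - v (2*n+1) t) - ln (v (2*n+1) t)) / 2) \<longlongrightarrow>
      (ln (2 - m (2*n+1)) - ln (m (2*n+1))) / 2) at_top"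
    using Suc.IH by (intro tendsto_intros v_tendsto) auto
  then have conv: "\<exists>L. ((\<lambda>t. \<Sum>k<Suc n. (ln (2 - v (2*k+1) t) - ln (v (2*k+1) t)) / 2) \<longlongrightarrow> L) at_top"
    unfolding sum.lessThan_Suc using Suc.IH tendsto_add by blast
  have m_even: "m (2 * Suc n) = 0"
    using m_stationary[of "2*n"] Suc.IH by simp
  then have "m (2*n+1) \<le> m (2 * Suc n + 1)"
    using m_le_if_0_between[of "2*n+1"] by simp
  moreover have "m (2 * Suc n + 1) < 2"
    using conv less_2_if_logit_sum_convergent[OF assms(1)] by blast
  ultimately show ?case
    using m_even conv Suc.IH by auto
qed

text \<open>\<open>h\<close> is the relative entropy from \<open>binary_entropy_ge\<close>, with
  value 0 at \<open>a\<close>. Along the flow \<open>h (v i t)\<close> has derivative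
  \<open>(v i t - a) * (v (i - 1) t - v (i + 1) t)\<close>, and \<open>- ln (1 - v i t / 2)\<close>
  has the same with \<open>a\<close> replaced by 0. Using \<open>h\<close> at odd and the logarithm
  at even indices, everything cancels except at the two ends.\<close>

lemma entropy_deriv:
  fixes a :: real
  assumes "0 < t"
  defines "h \<equiv> \<lambda>s. (2 - a)/2 * ln (2 - a) + a/2 * ln a - ((2 - a)/2 * ln (2 - s) + a/2 * ln s)"
  shows "((\<lambda>t. h (v (Suc (2*p)) t) +
      (\<Sum>j<d. - ln (1 - v (Suc (Suc (2*(p+j)))) t / 2) + h (v (Suc (Suc (Suc (2*(p+j))))) t)))
    has_real_derivative
    (v (Suc (2*p)) t - a) * v (2*p) t
      - (v (Suc (2*(p+d))) t - a) * v (Suc (Suc (2*(p+d)))) t) (at t)"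
proof (induction d)
  have h_deriv: "((\<lambda>t. h (v (Suc i) t)) has_real_derivative
      (v (Suc i) t - a) * (v i t - v (Suc (Suc i)) t)) (at t)" for i
    unfolding h_def using v_deriv[OF assms(1), of i] v_Suc_bounds[OF assms(1), of i]
    by (auto intro!: derivative_eq_intros simp: divide_simps) algebra
  {
    case 0
    show ?case
      using h_deriv[of "2*p"] by (simp add: algebra_simps)
  next
    case (Suc d)
    define i where "i = 2*(p+d)"
    have i': "2*(p + Suc d) = Suc (Suc i)"
      unfolding i_def by simp
    have "((\<lambda>t. - ln (1 - v (Suc (Suc i)) t / 2)) has_real_derivative
        v (Suc (Suc i)) t * (v (Suc i) t - v (Suc (Suc (Suc i))) t)) (at t)"
      using v_deriv[OF assms(1), of "Suc i"] v_Suc_bounds[OF assms(1), of "Suc i"]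
      by (auto intro!: derivative_eq_intros simp: field_simps)
    from DERIV_add[OF Suc.IH DERIV_add[OF this h_deriv[of "Suc (Suc i)"]]] show ?case
      unfolding sum.lessThan_Suc i' i_def[symmetric] add.assoc
      by (rule DERIV_cong) algebra
  }
qed

text \<open>The entropy relative to the common limit \<open>a\<close> of a block tends to 0, and only the two ends of the block
  contribute to its derivative; so exponentially small ends force an exponentially small interior.\<close>

lemma exp_small_if_m_odd_constant:
  assumes "0 < m (Suc (2*p))" "m (Suc (2*p)) < 2"
    and const: "\<And>j. j \<le> Suc d \<Longrightarrow> m (Suc (2*(p+j))) = m (Suc (2*p))"
    and even: "\<And>j. j \<le> Suc d \<Longrightarrow> m (2*(p+j)) = 0"
    and small: "exp_small (v (2*p))" "exp_small (v (Suc (Suc (2*(p + Suc d)))))"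
  shows "exp_small (v (Suc (Suc (2*(p+d)))))"
proof -
  define a where "a = m (Suc (2*p))"
  define h where "h = (\<lambda>s. (2 - a)/2 * ln (2 - a) + a/2 * ln a - ((2 - a)/2 * ln (2 - s) + a/2 * ln s))"
  \<comment> \<open>The block consists of the odd indices from \<open>2*p+1\<close> to
    \<open>2*(p+d)+3\<close>. The last even index between them, \<open>2*(p+d)+2\<close>, is the one
    in the conclusion.\<close>
  define H where "H = (\<lambda>t. h (v (Suc (2*p)) t) + (\<Sum>j<Suc d.
      - ln (1 - v (Suc (Suc (2*(p+j)))) t / 2) + h (v (Suc (Suc (Suc (2*(p+j))))) t)))"
  define H' where "H' = (\<lambda>t. (v (Suc (2*p)) t - a) * v (2*p) t
      - (v (Suc (2*(p + Suc d))) t - a) * v (Suc (Suc (2*(p + Suc d)))) t)"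
  have a: "0 < a" "a < 2"
    using assms(1,2) unfolding a_def by auto
  have bound: "\<forall>\<^sub>F t in at_top. \<bar>v (Suc i) t - a\<bar> \<le> 4" for i
    using eventually_gt_at_top[of 0]
  proof eventually_elim
    case (elim t)
    then show ?case
      using v_Suc_bounds[OF elim, of i] a by (simp add: abs_le_iff)
  qed
  have "\<forall>\<^sub>F t in at_top. (H has_real_derivative H' t) (at t)"
    using eventually_gt_at_top[of 0]
    by eventually_elim (unfold H_def H'_def h_def, rule entropy_deriv)
  moreover have "exp_small H'"
    unfolding H'_def
  proof (intro exp_small_diff exp_small_mult_bounded[where K = 4] small)
    show "\<forall>\<^sub>F t in at_top. \<bar>v (Suc (2*p)) t - a\<bar> \<le> 4"
      by (rule bound)
    show "\<forall>\<^sub>F t in at_top. \<bar>v (Suc (2*(p + Suc d))) t - a\<bar> \<le> 4"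
      by (rule bound)
  qed
  moreover have "(H \<longlongrightarrow> 0) at_top"
  proof -
    have h_a: "h a = 0"
      unfolding h_def by simp
    have h_tendsto: "((\<lambda>t. h (v (Suc (2*(p+j))) t)) \<longlongrightarrow> h a) at_top" if "j \<le> Suc d" for j
    proof -
      have "(v (Suc (2*(p+j))) \<longlongrightarrow> a) at_top"
        using v_tendsto[of "Suc (2*(p+j))"] const[OF that] unfolding a_def by simp
      then show ?thesis
        unfolding h_def using a by (intro tendsto_intros) auto
    qed
    have "(H \<longlongrightarrow> 0 + (\<Sum>j<Suc d. - ln (1 - 0 / 2) + 0)) at_top"
      unfolding H_def
    proof (intro tendsto_add tendsto_sum)
      show "((\<lambda>t. h (v (Suc (2*p)) t)) \<longlongrightarrow> 0) at_top"
        using h_tendsto[of 0] h_a by simp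
      fix j assume "j \<in> {..<Suc d}"
      then have j: "Suc j \<le> Suc d"
        by simp
      show "((\<lambda>t. h (v (Suc (Suc (Suc (2*(p+j))))) t)) \<longlongrightarrow> 0) at_top"
        using h_tendsto[OF j] h_a by simp
      have "(v (Suc (Suc (2*(p+j)))) \<longlongrightarrow> 0) at_top"
        using v_tendsto[of "Suc (Suc (2*(p+j)))"] even[OF j] by simp
      then show "((\<lambda>t. - ln (1 - v (Suc (Suc (2*(p+j)))) t / 2)) \<longlongrightarrow> - ln (1 - 0 / 2)) at_top"
        by (intro tendsto_intros) auto
    qed
    then show ?thesis by simp
  qed
  ultimately have "exp_small H"
    by (rule exp_small_if_deriv_exp_small)
  \<comment> \<open>All terms of \<open>H\<close> are nonnegative. Keeping only the last logarithm
    and using \<open>- ln (1 - x) \<ge> x\<close> gives the factor 2.\<close>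
  then show ?thesis
  proof (rule exp_small_mono)
    show "\<forall>\<^sub>F t in at_top. \<bar>v (Suc (Suc (2*(p+d)))) t\<bar> \<le> 2 * \<bar>H t\<bar>"
      using eventually_gt_at_top[of 0]
    proof eventually_elim
      case (elim t)
      have h_nonneg: "0 \<le> h (v (Suc i) t)" for i
        unfolding h_def using binary_entropy_ge[OF a v_Suc_bounds[OF elim]] by simp
      have ln_ge: "v (Suc i) t / 2 \<le> - ln (1 - v (Suc i) t / 2)" for i
        using ln_le_minus_one[of "1 - v (Suc i) t / 2"] v_Suc_bounds[OF elim, of i] by simp
      have "0 \<le> - ln (1 - v (Suc i) t / 2)" for i
        using ln_ge[of i] v_bounds(1)[OF elim, of "Suc i"] by linarith
      then have "0 \<le> (\<Sum>j<d. - ln (1 - v (Suc (Suc (2*(p+j)))) t / 2) + h (v (Suc (Suc (Suc (2*(p+j))))) t))"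
        using h_nonneg by (intro sum_nonneg add_nonneg_nonneg)
      then have "- ln (1 - v (Suc (Suc (2*(p+d)))) t / 2) + h (v (Suc (Suc (Suc (2*(p+d))))) t) \<le> H t"
        unfolding H_def sum.lessThan_Suc using h_nonneg[of "2*p"] by linarith
      then show ?case
        using ln_ge[of "Suc (2*(p+d))"] h_nonneg[of "Suc (Suc (2*(p+d)))"] v_bounds(1)[OF elim]
        by (simp add: abs_le_iff)
    qed
  qed
qed

text \<open>Odd limits are nondecreasing, so a failure means a block of equal limits followed by a
  strictly larger one. The even variables at both ends of the block are then exponentially small,
  hence so is \<open>v (2*n+2)\<close> inside it, although its neighbours have equal limits.\<close>

lemma m_odd_stationary:
  assumes "exp_small (v 0)" "0 < m 1" "m (2*n+1) = m (2*n+3)"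
  shows "m (2*n+3) = m (2*n+5)"
proof (rule ccontr)
  assume neq: "m (2*n+3) \<noteq> m (2*n+5)"
  have even: "m (2*j) = 0" and odd: "0 < m (Suc (2*j))" "m (Suc (2*j)) < 2" for j
    using limits_if_exp_small_0[OF assms(1,2), of j] by auto
  have mono: "m (Suc (2*i)) \<le> m (Suc (2*j))" if "i \<le> j" for i j
    using that
  proof (rule lift_Suc_mono_le[of "\<lambda>j. m (Suc (2*j))", rotated])
    show "m (Suc (2*j)) \<le> m (Suc (2 * Suc j))" for j
      using m_le_if_0_between[of "Suc (2*j)"] even[of "Suc j"] by simp
  qed
  \<comment> \<open>The left end of the block: either \<open>p = 0\<close>, where \<open>v 0\<close>
    is small by assumption, or the odd limit before it is strictly smaller.\<close>
  define p where "p = (LEAST p. m (Suc (2*p)) = m (Suc (2*n)))"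
  have p: "m (Suc (2*p)) = m (Suc (2*n))"
    unfolding p_def by (rule LeastI[of _ n]) simp
  have "p \<le> n"
    unfolding p_def by (rule Least_le) simp
  then obtain d where d: "n = p + d"
    using le_Suc_ex by blast
  have small: "exp_small (v (2*p))"
  proof (cases p)
    case 0
    then show ?thesis using assms(1) by simp
  next
    case (Suc q)
    then have "m (Suc (2*q)) \<noteq> m (Suc (2*p))"
      using not_less_Least[of q "\<lambda>p. m (Suc (2*p)) = m (Suc (2*n))"] p unfolding p_def by auto
    then have "m (Suc (2*q)) < m (Suc (2*p))"
      using mono[of q p] Suc by simp
    then show ?thesis
      using exp_small_if_m_less[of "Suc (2*q)"] even[of "Suc q"] Suc by simp
  qed
  have small': "exp_small (v (Suc (Suc (2*(p + Suc d)))))"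
  proof (rule exp_small_if_m_less)
    show "m (Suc (Suc (2*(p + Suc d)))) = 0"
      using even[of "Suc (p + Suc d)"] by simp
    have "m (Suc (2*(n+1))) \<le> m (Suc (2*(n+2)))"
      by (rule mono) simp
    then show "m (Suc (2*(p + Suc d))) < m (Suc (Suc (Suc (2*(p + Suc d)))))"
      using neq d by (simp add: eval_nat_numeral)
  qed
  have const: "m (Suc (2*(p+j))) = m (Suc (2*p))" if "j \<le> Suc d" for j
  proof (rule antisym)
    have "m (Suc (2*(p+j))) \<le> m (Suc (2*(n+1)))"
      using that d by (intro mono) simp
    then show "m (Suc (2*(p+j))) \<le> m (Suc (2*p))"
      using p assms(3) by (simp add: eval_nat_numeral)
  qed (rule mono, simp)
  have "exp_small (v (Suc (Suc (2*(p+d)))))"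
    by (rule exp_small_if_m_odd_constant[OF odd const even small small'])
  moreover have "\<not> exp_small (v (Suc (Suc (2*(p+d)))))"
    using assms(3) d by (intro not_exp_small_if_m_eq) (simp add: eval_nat_numeral)
  ultimately show False by blast
qed

end

subsection \<open>The complex system\<close>

lemma Im_schur_flow_deriv:
  assumes "schur_flow_solution a" "0 \<le> t"
  shows "((\<lambda>t. Im (a n t)) has_real_derivative
    (1 - (cmod (a n t))\<^sup>2) * (Im (a (Suc n) t) - (if n = 0 then 0 else Im (a (n - 1) t)))) (at t within {0..})"
proof -
  have "(a n has_vector_derivative (of_real (1 - (cmod (a n t))\<^sup>2) *
      (a (Suc n) t - (if n = 0 then -1 else a (n - 1) t)))) (at t within {0..})"
    using assms unfolding schur_flow_solution_def by blast
  from bounded_linear.has_vector_derivative[OF bounded_linear_Im this] show ?thesis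
    unfolding has_real_derivative_iff_has_vector_derivative by (auto split: if_splits)
qed

text \<open>Picard iteration: the imaginary parts satisfy a linear system with bounded coefficients and zero
  initial data.\<close>

lemma abs_Im_schur_flow_le:
  assumes "schur_flow_solution a" "\<And>n. Im (a n 0) = 0" "0 \<le> t"
  shows "\<bar>Im (a n t)\<bar> \<le> (2 * t) ^ k / fact k"
  using assms(3)
proof (induction k arbitrary: n t)
  case 0
  then have "cmod (a n t) < 1"
    using assms(1) unfolding schur_flow_solution_def by blast
  then show ?case
    using abs_Im_le_cmod[of "a n t"] by simp
next
  case (Suc k)
  \<comment> \<open>\<open>F\<close> is the next bound; its derivative is twice the previous one.
    The 2 accounts for the two neighbours, as the factor \<open>1 - (cmod (a n t))\<^sup>2\<close>
    is at most 1.\<close>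
  define F :: "real \<Rightarrow> real" where "F = (\<lambda>t. (2 * t) ^ Suc k / fact (Suc k))"
  define D where "D = (\<lambda>t. (1 - (cmod (a n t))\<^sup>2) *
    (Im (a (Suc n) t) - (if n = 0 then 0 else Im (a (n - 1) t))))"
  have F_deriv: "(F has_real_derivative 2 * ((2 * s) ^ k / fact k)) (at s)" for s
  proof -
    have "((\<lambda>t. 2 * t) has_real_derivative 2) (at s)"
      by (auto intro!: derivative_eq_intros)
    moreover have "1 + real k \<noteq> 0"
      by linarith
    then have "(1 + real k) * (2 * (2 * s) ^ k) / fact (Suc k) = 2 * ((2 * s) ^ k / fact k)"
      by (simp add: nonzero_mult_divide_mult_cancel_left del: power_mult_distrib)
    ultimately show ?thesis
      unfolding F_def by (metis DERIV_cdivide DERIV_power_Suc)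
  qed
  have D_deriv: "((\<lambda>t. Im (a n t)) has_real_derivative D s) (at s)" if "0 < s" for s
  proof -
    have "at s within {0..} = at s"
      using that by (intro at_within_interior) auto
    then show ?thesis
      using Im_schur_flow_deriv[OF assms(1), of s n] that unfolding D_def by simp
  qed
  have D_le: "\<bar>D s\<bar> \<le> 2 * ((2 * s) ^ k / fact k)" if "0 < s" for s
  proof -
    have "cmod (a n s) < 1"
      using assms(1) that unfolding schur_flow_solution_def by simp
    then have "\<bar>1 - (cmod (a n s))\<^sup>2\<bar> \<le> 1"
      by (simp add: abs_le_iff power_le_one)
    moreover have "\<bar>Im (a (Suc n) s) - (if n = 0 then 0 else Im (a (n - 1) s))\<bar> \<le> 2 * ((2 * s) ^ k / fact k)"
      using Suc.IH[of s "Suc n"] Suc.IH[of s "n - 1"] that by auto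
    ultimately show ?thesis
      unfolding D_def abs_mult using mult_mono[of _ 1] by fastforce
  qed
  have cont: "continuous_on {0..t} (\<lambda>t. Im (a n t))"
    by (rule continuous_on_subset[OF DERIV_continuous_on[OF Im_schur_flow_deriv[OF assms(1)]]]) auto
  have F_cont: "continuous_on {0..t} F"
    unfolding F_def by (intro continuous_intros) auto
  \<comment> \<open>Both \<open>F - Im\<close> and \<open>F + Im\<close> are nondecreasing on
    \<open>{0..t}\<close> and vanish at 0.\<close>
  have "F 0 - Im (a n 0) \<le> F t - Im (a n t)"
  proof (rule DERIV_nonneg_imp_increasing_open[OF Suc.prems])
    show "\<exists>y. ((\<lambda>s. F s - Im (a n s)) has_real_derivative y) (at s) \<and> 0 \<le> y" if "0 < s" "s < t" for s
      using DERIV_diff[OF F_deriv D_deriv[OF that(1)]] D_le[OF that(1)] by (intro exI conjI) auto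
  qed (intro continuous_on_diff F_cont cont)
  moreover have "F 0 + Im (a n 0) \<le> F t + Im (a n t)"
  proof (rule DERIV_nonneg_imp_increasing_open[OF Suc.prems])
    show "\<exists>y. ((\<lambda>s. F s + Im (a n s)) has_real_derivative y) (at s) \<and> 0 \<le> y" if "0 < s" "s < t" for s
      using DERIV_add[OF F_deriv D_deriv[OF that(1)]] D_le[OF that(1)] by (intro exI conjI) auto
  qed (intro continuous_on_add F_cont cont)
  ultimately show ?case
    using assms(2)[of n] unfolding F_def by (simp add: abs_le_iff)
qed

text \<open>The bound holds for every \<open>k\<close> at fixed \<open>t\<close>, and
  \<open>(2 * t) ^ k / fact k\<close> tends to 0.\<close>

lemma Im_schur_flow_eq_0:
  assumes "schur_flow_solution a" "\<And>n. Im (a n 0) = 0" "0 \<le> t"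
  shows "Im (a n t) = 0"
proof -
  have "(\<lambda>k. (2 * t) ^ k / fact k) \<longlonglongrightarrow> 0"
    using summable_LIMSEQ_zero[OF summable_exp_generic[of "2 * t"]] by (simp add: field_simps)
  then have "\<bar>Im (a n t)\<bar> \<le> 0"
    using abs_Im_schur_flow_le[OF assms] by (intro tendsto_lowerbound[where F = sequentially]) auto
  then show ?thesis by simp
qed

text \<open>The index is shifted: \<open>twisted a 0\<close> belongs to \<open>\<alpha>\<^sub>-\<^sub>1 = -1\<close>.\<close>

definition twisted :: "(nat \<Rightarrow> real \<Rightarrow> complex) \<Rightarrow> nat \<Rightarrow> real \<Rightarrow> real" where
  "twisted a n t = (case n of 0 \<Rightarrow> 0 | Suc k \<Rightarrow> 1 - (-1) ^ k * Re (a k t))"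

lemma schur_flow_twisted:
  assumes "schur_flow_solution a" "\<And>n. Im (a n 0) = 0"
  shows "schur_flow (twisted a)"
proof
  fix n and t :: real assume t: "0 < t"
  show "0 \<le> twisted a 0 t" "twisted a 0 t \<le> 2"
    unfolding twisted_def by auto
  have cmod_eq: "cmod (a n t) = \<bar>Re (a n t)\<bar>"
    using Im_schur_flow_eq_0[OF assms, of t n] t by (simp add: cmod_eq_Re)
  have "cmod (a n t) < 1"
    using assms(1) t unfolding schur_flow_solution_def by simp
  then have "\<bar>(-1) ^ n * Re (a n t)\<bar> < 1"
    using cmod_eq by (simp add: abs_mult)
  then show "0 < twisted a (Suc n) t" "twisted a (Suc n) t < 2"
    unfolding twisted_def by auto
  have "at t within {0..} = at t"
    using t by (intro at_within_interior) auto
  then have "(a n has_vector_derivative (of_real (1 - (cmod (a n t))\<^sup>2) *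
      (a (Suc n) t - (if n = 0 then -1 else a (n - 1) t)))) (at t)"
    using assms(1) t unfolding schur_flow_solution_def by (metis less_imp_le)
  from bounded_linear.has_vector_derivative[OF bounded_linear_Re this]
  have "((\<lambda>t. Re (a n t)) has_real_derivative
      (1 - (Re (a n t))\<^sup>2) * (Re (a (Suc n) t) - (if n = 0 then - 1 else Re (a (n - 1) t)))) (at t)"
    unfolding has_real_derivative_iff_has_vector_derivative using cmod_eq by (auto split: if_splits)
  from DERIV_diff[OF DERIV_const DERIV_cmult[OF this]]
  have "(twisted a (Suc n) has_real_derivative 0 - (-1) ^ n * 
      ((1 - (Re (a n t))\<^sup>2) * (Re (a (Suc n) t) - (if n = 0 then - 1 else Re (a (n - 1) t))))) (at t)"
    unfolding twisted_def by simp
  \<comment> \<open>\<open>x * (2 - x)\<close> at \<open>x = twisted a (Suc n) t\<close> is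
    \<open>1 - (Re (a n t))\<^sup>2\<close>, and both neighbours carry the sign opposite to
    \<open>(-1) ^ n\<close>. For \<open>n = 0\<close> the boundary value \<open>-1\<close>
    corresponds to \<open>twisted a 0 t = 0\<close>.\<close>
  moreover have "0 - (-1) ^ n *
      ((1 - (Re (a n t))\<^sup>2) * (Re (a (Suc n) t) - (if n = 0 then - 1 else Re (a (n - 1) t)))) =
      twisted a (Suc n) t * (2 - twisted a (Suc n) t) * (twisted a n t - twisted a (Suc (Suc n)) t)"
    by (cases n; cases "even n") (auto simp: twisted_def algebra_simps power2_eq_square)
  ultimately show "(twisted a (Suc n) has_real_derivative
      twisted a (Suc n) t * (2 - twisted a (Suc n) t) * (twisted a n t - twisted a (Suc (Suc n)) t)) (at t)"
    by simp
qed

lemma tendsto_if_twisted_tendsto: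
  assumes "schur_flow_solution a" "\<And>n. Im (a n 0) = 0" "(twisted a (Suc n) \<longlongrightarrow> L) at_top"
  shows "(a n \<longlongrightarrow> of_real ((-1) ^ n * (1 - L))) at_top"
proof -
  have "((\<lambda>t. complex_of_real ((-1) ^ n * (1 - twisted a (Suc n) t))) \<longlongrightarrow> of_real ((-1) ^ n * (1 - L))) at_top"
    by (intro tendsto_intros assms(3))
  moreover have "\<forall>\<^sub>F t in at_top. complex_of_real ((-1) ^ n * (1 - twisted a (Suc n) t)) = a n t"
    using eventually_ge_at_top[of 0]
  proof eventually_elim
    case (elim t)
    have "(-1) ^ n * (1 - twisted a (Suc n) t) = Re (a n t)"
      by (cases "even n") (auto simp: twisted_def)
    then show ?case
      using Im_schur_flow_eq_0[OF assms(1,2) elim] by (simp add: complex_eq_iff del: of_real_mult)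
  qed
  ultimately show ?thesis
    by (rule Lim_transform_eventually)
qed

text \<open>By \<open>stat\<close> the sequence is constant once it stalls. So it is strictly
  decreasing forever, with \<open>N = \<infinity>\<close>, or strictly decreasing up to its first
  stall and constant afterwards.\<close>

lemma admissible_params_exist:
  fixes y :: "nat \<Rightarrow> real"
  assumes bounds: "\<And>n. -1 < y n \<and> y n < 1"
    and decr: "\<And>n. y (Suc n) \<le> y n"
    and stat: "\<And>n. y (Suc n) = y n \<Longrightarrow> y (Suc (Suc n)) = y (Suc n)"
  obtains N x where "admissible_params N x"
    "\<And>n. enat n < N \<Longrightarrow> x (Suc n) = y n" "\<And>n. N \<le> enat (Suc n) \<Longrightarrow> x (the_enat N) = y n"
proof -
  have less: "y j < y i" if "i < j" "\<And>l. l < j \<Longrightarrow> y (Suc l) \<noteq> y l" for i j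
    using that
  proof (induction j)
    case (Suc j)
    have "y (Suc j) < y j"
      using decr[of j] Suc.prems(2)[of j] by simp
    then show ?case
      using Suc by (cases "i = j") (auto intro: less_trans)
  qed simp
  \<comment> \<open>The parameters are counted from 1, the sequence \<open>y\<close> from 0.\<close>
  define x where "x = (\<lambda>n. y (n - 1))"
  show ?thesis
  proof (cases "\<exists>k. y (Suc k) = y k")
    case False
    then have "admissible_params \<infinity> x"
      unfolding admissible_params_def x_def using bounds less by auto
    then show ?thesis
      using that[of \<infinity> x] unfolding x_def by auto
  next
    case True
    \<comment> \<open>The strictly decreasing values are \<open>y 0\<close> to \<open>y k\<close>,
      so there are \<open>Suc k\<close> parameters.\<close>
    define k where "k = (LEAST k. y (Suc k) = y k)"
    have k: "y (Suc k) = y k"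
      unfolding k_def using True by (rule LeastI_ex)
    have neq: "y (Suc l) \<noteq> y l" if "l < k" for l
      using that not_less_Least unfolding k_def by blast
    have "y (Suc (k + d)) = y (k + d)" for d
      by (induction d) (use k stat in auto)
    then have const: "y (k + d) = y k" for d
      by (induction d) auto
    show ?thesis
    proof (rule that[of "enat (Suc k)" x])
      show "admissible_params (enat (Suc k)) x"
        unfolding admissible_params_def x_def using bounds less neq by (auto simp: one_enat_def)
      show "x (Suc n) = y n" for n
        unfolding x_def by simp
      show "x (the_enat (enat (Suc k))) = y n" if "enat (Suc k) \<le> enat (Suc n)" for n
        using const[of "n - k"] that unfolding x_def by simp
    qed
  qed
qed

lemma (in convergent_schur_flow) admissible_limits:
  assumes "exp_small (v 0)" "0 < m 1"
  obtains N x where "admissible_params N x" "\<And>n. enat n < N \<Longrightarrow> x (Suc n) = 1 - m (2*n+1)"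
    "\<And>n. N \<le> enat (Suc n) \<Longrightarrow> x (the_enat N) = 1 - m (2*n+1)"
proof (rule admissible_params_exist[of "\<lambda>n. 1 - m (2*n+1)"])
  note lims = limits_if_exp_small_0[OF assms]
  show "-1 < 1 - m (2*n+1) \<and> 1 - m (2*n+1) < 1" for n
    using lims[of n] by auto
  show "1 - m (2 * Suc n + 1) \<le> 1 - m (2*n+1)" for n
    using m_le_if_0_between[of "2*n+1"] lims[of "Suc n"] by simp
  show "1 - m (2 * Suc (Suc n) + 1) = 1 - m (2 * Suc n + 1)"
    if "1 - m (2 * Suc n + 1) = 1 - m (2*n+1)" for n
    using m_odd_stationary[OF assms, of n] that by (simp add: eval_nat_numeral)
qed (rule that)

section \<open>Mutual exclusion of the three cases\<close>

lemma case_i_limits: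
  assumes "case_i \<alpha>"
  shows "(\<alpha> 0 \<longlongrightarrow> 1) at_top" "(\<alpha> 1 \<longlongrightarrow> -1) at_top"
proof -
  have "(\<alpha> n \<longlongrightarrow> of_real ((-1) ^ n)) at_top" for n
    using assms unfolding case_i_def by blast
  from this[of 0] this[of 1] show "(\<alpha> 0 \<longlongrightarrow> 1) at_top" "(\<alpha> 1 \<longlongrightarrow> -1) at_top"
    by simp_all
qed

lemma case_ii_limits:
  assumes "case_ii \<alpha>"
  obtains c :: real where "(\<alpha> 0 \<longlongrightarrow> 1) at_top" "(\<alpha> 1 \<longlongrightarrow> of_real (- c)) at_top" "-1 < c" "c < 1"
proof -
  obtain N x where Nx: "admissible_params N x" "\<And>n. (\<alpha> (2*n) \<longlongrightarrow> 1) at_top"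
    "\<And>n. 1 \<le> n \<Longrightarrow> enat n < N \<Longrightarrow> (\<alpha> (2*n - 1) \<longlongrightarrow> of_real (- x n)) at_top"
    "\<And>n. 1 \<le> n \<Longrightarrow> N \<le> enat n \<Longrightarrow> (\<alpha> (2*n - 1) \<longlongrightarrow> of_real (- x (the_enat N))) at_top"
    using assms unfolding case_ii_def by blast
  have N: "1 \<le> N"
    using Nx(1) unfolding admissible_params_def by blast
  have "(\<alpha> 1 \<longlongrightarrow> of_real (- x 1)) at_top"
  \<comment> \<open>For \<open>N = 1\<close> the index 1 already belongs to the constant tail; both
    clauses give the limit \<open>- x 1\<close>.\<close>
  proof (cases "enat 1 < N")
    case True
    then show ?thesis using Nx(3)[of 1] by simp
  next
    case False
    then have "N = enat 1"
      using N by (simp add: one_enat_def)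
    then show ?thesis using Nx(4)[of 1] by simp
  qed
  moreover have "-1 < x 1 \<and> x 1 < 1"
    using Nx(1) N unfolding admissible_params_def by (simp add: one_enat_def)
  ultimately show ?thesis
    using that Nx(2)[of 0] by simp
qed

lemma case_iii_limits:
  assumes "case_iii \<alpha>"
  obtains c :: real where "(\<alpha> 0 \<longlongrightarrow> of_real c) at_top" "c < 1"
proof -
  obtain N x where Nx: "admissible_params N x"
    "\<And>n. enat n < N \<Longrightarrow> (\<alpha> (2*n) \<longlongrightarrow> of_real (x (n + 1))) at_top"
    using assms unfolding case_iii_def by blast
  have N: "enat 1 \<le> N"
    using Nx(1) unfolding admissible_params_def by (simp add: one_enat_def)
  then have "enat 0 < N"
    by (rule less_le_trans[rotated]) simp
  then have "(\<alpha> 0 \<longlongrightarrow> of_real (x 1)) at_top"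
    using Nx(2)[of 0] by simp
  moreover have "x 1 < 1"
    using Nx(1) N unfolding admissible_params_def by simp
  ultimately show ?thesis using that by blast
qed

theorem theorem1p1:
  fixes \<alpha> :: "nat \<Rightarrow> real \<Rightarrow> complex"
  assumes "schur_flow_solution \<alpha>"
    and "\<And>n. \<alpha> n 0 \<in> complex_of_real ` {-1<..<1}"
  shows "(case_i \<alpha> \<and> \<not> case_ii \<alpha> \<and> \<not> case_iii \<alpha>) \<or>
         (\<not> case_i \<alpha> \<and> case_ii \<alpha> \<and> \<not> case_iii \<alpha>) \<or>
         (\<not> case_i \<alpha> \<and> \<not> case_ii \<alpha> \<and> case_iii \<alpha>)"
proof -
  have Im_0: "Im (\<alpha> n 0) = 0" for n
    using assms(2)[of n] by auto
  interpret schur_flow "twisted \<alpha>"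
    by (rule schur_flow_twisted[OF assms(1) Im_0])
  have v_0: "twisted \<alpha> 0 t = 0" for t
    by (simp add: twisted_def)
  obtain m where m: "\<And>n. (twisted \<alpha> n \<longlongrightarrow> m n) at_top"
    using convergent_if_v_0_eq_0[OF v_0] by metis
  interpret convergent_schur_flow "twisted \<alpha>" m
    by unfold_locales (rule m)
  have alpha_tendsto: "(\<alpha> n \<longlongrightarrow> of_real ((-1) ^ n * (1 - m (Suc n)))) at_top" for n
    by (rule tendsto_if_twisted_tendsto[OF assms(1) Im_0 m])
  have small_0: "exp_small (twisted \<alpha> 0)"
    unfolding exp_small_def by (intro exI[of _ 1] exI[of _ 0] conjI) (auto simp: v_0)
  have "case_i \<alpha> \<or> case_ii \<alpha> \<or> case_iii \<alpha>"
  proof -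
    \<comment> \<open>\<open>m 1 = 0\<close> says that \<open>\<alpha> 0\<close> tends to 1, and
      \<open>m 2 = 0\<close> that \<open>\<alpha> 1\<close> tends to -1. The branches lead to (i),
      (ii) and (iii) in this order.\<close>
    consider "m 1 = 0" "m 2 = 0" | "m 1 = 0" "0 < m 2" | "0 < m 1"
      using m_bounds(1)[of 1] m_bounds(1)[of 2] by linarith
    then show ?thesis
    proof cases
      case 1
      then have "m n = 0" for n
        by (rule tendsto_0_if_m_1_2_eq_0[OF v_0])
      then have "case_i \<alpha>"
        unfolding case_i_def using alpha_tendsto by simp
      then show ?thesis by blast
    next
      case 2
      have "m 0 = 0"
        using tendsto_unique[OF trivial_limit_at_top_linorder m exp_small_tendsto_0[OF small_0]] .
      then have small_1: "exp_small (twisted \<alpha> (Suc 0))"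
        using 2 by (intro exp_small_if_m_less) (auto simp: numeral_2_eq_2)
      \<comment> \<open>After the shift \<open>twisted \<alpha> 1\<close> is the boundary variable.
        It is not zero but exponentially small, because \<open>m 0 = 0 < m 2\<close>; odd and even
        indices exchange their roles.\<close>
      interpret sh: convergent_schur_flow "\<lambda>n. twisted \<alpha> (Suc n)" "\<lambda>n. m (Suc n)"
        by (rule shift)
      have pos: "0 < m (Suc 1)"
        using 2 by (simp add: numeral_2_eq_2)
      obtain N x where Nx: "admissible_params N x"
        "\<And>n. enat n < N \<Longrightarrow> x (Suc n) = 1 - m (Suc (2*n+1))"
        "\<And>n. N \<le> enat (Suc n) \<Longrightarrow> x (the_enat N) = 1 - m (Suc (2*n+1))"
        by (rule sh.admissible_limits[OF small_1 pos]) blast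
      have m_odd: "m (Suc (2*n)) = 0" for n
        using sh.limits_if_exp_small_0[OF small_1 pos] by blast
      have "(\<alpha> (2*n) \<longlongrightarrow> 1) at_top" for n
        using alpha_tendsto[of "2*n"] m_odd[of n] by simp
      moreover have odd: "(\<alpha> (2 * Suc n - 1) \<longlongrightarrow> of_real (- (1 - m (Suc (2*n+1))))) at_top" for n
        using alpha_tendsto[of "2*n+1"] by simp
      have "(\<alpha> (2*n - 1) \<longlongrightarrow> of_real (- x n)) at_top" if n: "1 \<le> n" "enat n < N" for n
      proof -
        \<comment> \<open>Case (ii) counts its variables from 1, while \<open>odd\<close> and
          \<open>Nx\<close> count from 0.\<close>
        obtain k where k: "n = Suc k"
          using n(1) by (cases n) auto
        have "enat k < N"
          using n(2) k by (meson enat_ord_simps(2) lessI less_trans)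
        then show ?thesis
          using odd[of k] Nx(2)[of k] k by simp
      qed
      moreover have "(\<alpha> (2*n - 1) \<longlongrightarrow> of_real (- x (the_enat N))) at_top" if n: "1 \<le> n" "N \<le> enat n" for n
      proof -
        obtain k where k: "n = Suc k"
          using n(1) by (cases n) auto
        then show ?thesis
          using odd[of k] Nx(3)[of k] that(2) by simp
      qed
      ultimately have "case_ii \<alpha>"
        unfolding case_ii_def using Nx(1) by blast
      then show ?thesis by blast
    next
      case 3
      obtain N x where Nx: "admissible_params N x"
        "\<And>n. enat n < N \<Longrightarrow> x (Suc n) = 1 - m (2*n+1)"
        "\<And>n. N \<le> enat (Suc n) \<Longrightarrow> x (the_enat N) = 1 - m (2*n+1)"
        by (rule admissible_limits[OF small_0 3]) blast
      have m_even: "m (2*n) = 0" for n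
        using limits_if_exp_small_0[OF small_0 3] by blast
      have "(\<alpha> (2*n+1) \<longlongrightarrow> -1) at_top" for n
        using alpha_tendsto[of "2*n+1"] m_even[of "Suc n"] by simp
      moreover have even: "(\<alpha> (2*n) \<longlongrightarrow> of_real (1 - m (2*n+1))) at_top" for n
        using alpha_tendsto[of "2*n"] by simp
      have "(\<alpha> (2*n) \<longlongrightarrow> of_real (x (n+1))) at_top" if "enat n < N" for n
        using even[of n] Nx(2)[OF that] by simp
      moreover have "(\<alpha> (2*n) \<longlongrightarrow> of_real (x (the_enat N))) at_top" if "N \<le> enat (n+1)" for n
        using even[of n] Nx(3)[of n] that by simp
      ultimately have "case_iii \<alpha>"
        unfolding case_iii_def using Nx(1) by blast
      then show ?thesis by blast
    qed
  qed
  \<comment> \<open>The limit of \<open>\<alpha> 1\<close> is -1 in (i) and larger in (ii); the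
    limit of \<open>\<alpha> 0\<close> is 1 in both and smaller in (iii).\<close>
  moreover have "\<not> (case_i \<alpha> \<and> case_ii \<alpha>)"
    by (auto elim!: case_ii_limits dest!: case_i_limits(2) dest: tendsto_unique[OF trivial_limit_at_top_linorder])
  moreover have "\<not> (case_i \<alpha> \<and> case_iii \<alpha>)"
    by (auto elim!: case_iii_limits dest!: case_i_limits(1) dest: tendsto_unique[OF trivial_limit_at_top_linorder])
  moreover have "\<not> (case_ii \<alpha> \<and> case_iii \<alpha>)"
    by (auto elim!: case_iii_limits case_ii_limits dest: tendsto_unique[OF trivial_limit_at_top_linorder])
  ultimately show ?thesis by blast
qed

end
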